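(* Let $X=(V,E,F)$ be a planar truss (form diagram) realized in $\mathbb{R}^2$ by $p:V\to\mathbb{R}^2$, with dual cell complex $\tilde X$. Let $w=(w_v)_{v\in V}$ be an infinitesimal motion of $X$ preserving all edge lengths to first order which is not a global translation (so that $w$ is a mechanism or a global rotation), and let $\rho(w)=(\rho(w)_e)_{e\in E}$ be the induced system of edge rotations. Then $\rho(w)$ is impossible to satisfy on any parallel force diagram, even when the dual edges are permitted to extend or contract axially; that is, for every force diagram $\xi:F\to\mathbb{R}^2$ of $X$ there is no infinitesimal displacement $\eta=(\eta_f)_{f\in F}$, $\eta_f\in\mathbb{R}^2$, of its vertices such that for every edge $e\in E$ the component perpendicular to $e$ of the relative displacement of the endpoints of the dual edge $\tilde e$ equals the prescribed rotation: $$P_{e^\perp}\bigl(\eta_{l(e)}-\eta_{r(e)}\bigr)=\rho(w)_e\quad\text{for all } e\in E .$$ Equivalently, $\rho(w)$ represents a nonzero class in the first homology $H_1\mathcal{G}$ of the position cosheaf $\mathcal{G}$ of $X$.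
   Context: Planar truss: $(V,E)$ is a finite connected planar graph, each edge joining two distinct vertices, drawn in $\mathbb{R}^2$ via $p:V\to\mathbb{R}^2$ with straight non-overlapping edges. $F$ is the set of polyhedral face regions including the unbounded exterior region, so that $X=(V,E,F)$ is a cell complex with the topology of the sphere $\mathbb{S}^2$. Fix an arbitrary orientation of each edge $e$ from tail $t(e)$ to head $h(e)$; let $l(e),r(e)\in F$ be the faces to the left and right of $e$, let $d_e=p(h(e))-p(t(e))$, and let $P_{e^\perp}:\mathbb{R}^2\to d_e^\perp$ be orthogonal projection onto the line perpendicular to $e$. The dual complex $\tilde X$ has a vertex $\tilde f$ for each $f\in F$ and an edge $\tilde e$ joining $\tilde l(e)$ and $\tilde r(e)$ for each $e\in E$. Position cosheaf $\mathcal{G}$: stalks $\mathcal{G}_f=\mathbb{R}^2$ on faces, $\mathcal{G}_e=\mathbb{R}^2/\mathbb{R}d_e\cong d_e^\perp$ on edges, $\mathcal{G}_v=0$ on vertices, with maps $\mathcal{G}_{f\rhd e}=P_{e^\perp}$. Its chain complex is $C_2\mathcal{G}=\bigoplus_f\mathcal{G}_f\xrightarrow{\ \partial\ }C_1\mathcal{G}=\bigoplus_e\mathcal{G}_e\to 0$ with $(\partial\eta)_e=P_{e^\perp}(\eta_{l(e)}-\eta_{r(e)})$. Thus $H_2\mathcal{G}=\ker\partial$ and $H_1\mathcal{G}=C_1\mathcal{G}/\operatorname{im}\partial$. A (parallel) force diagram, or parallel dual realization of $\tilde X$, is an element $\xi\in H_2\mathcal{G}$, i.e. an assignment $\xi:F\to\mathbb{R}^2$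 of positions to the dual vertices such that $\xi_{l(e)}-\xi_{r(e)}$ is parallel to $d_e$ for every edge $e$. Infinitesimal motions: $w=(w_v)_{v\in V}$ with $w_v\in\mathbb{R}^2$ preserves edge lengths to first order if $\langle w_{h(e)}-w_{t(e)},d_e\rangle=0$ for all $e$. It is a global translation if $w_v$ is the same vector for all $v$, a global rotation if it is a nonconstant motion of the form $w_v=c\,J\,p(v)+b$ with $c\neq0$, $b\in\mathbb{R}^2$, where $J$ is rotation by $90^\circ$, and a mechanism if it preserves edge lengths to first order but is not of the form $w_v=c\,Jp(v)+b$. The system of edge rotations of $w$ is $\rho(w)_e=w_{h(e)}-w_{t(e)}\in d_e^\perp\cong\mathcal{G}_e$. Prescribing the perpendicular displacement $\rho(w)_e$ on the dual edge (rather than an angular velocity) means that the sense of rotation of a dual edge is flipped according to whether $e$ is in tension or compression in $\xi$. *)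

theory Defs
  imports
    "HOL-Analysis.Analysis"
    "HOL-Algebra.Product_Groups"
    "Graph_Theory.Digraph_Component"
begin

text \<open>Unqualified \<open>connected\<close> is topological; graph connectivity is
  \<open>Digraph_Component.connected\<close>, which ignores arc directions.\<close>

hide_const (open) Digraph_Component.connected

section \<open>Planar trusses\<close>

text \<open>A graph whose edges carry an arbitrary orientation is a digraph. Parallel and antiparallel
  arcs are excluded by the disjointness of the open edge segments.\<close>

definition edge_vec :: "('v, 'e) pre_digraph \<Rightarrow> ('v \<Rightarrow> real^2) \<Rightarrow> 'e \<Rightarrow> real^2" where
  "edge_vec G p e = p (head G e) - p (tail G e)"

locale planar_truss = fin_digraph G + loopfree_digraph G
  for G :: "('v, 'e) pre_digraph" (structure) +
  fixes p :: "'v \<Rightarrow> real^2"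
  assumes connected_graph: "Digraph_Component.connected G"
    and inj_position: "inj_on p (verts G)"
    and vertex_not_in_edge:
      "e \<in> arcs G \<Longrightarrow> v \<in> verts G \<Longrightarrow> p v \<notin> open_segment (p (tail G e)) (p (head G e))"
    and edges_not_overlapping:
      "e \<in> arcs G \<Longrightarrow> e' \<in> arcs G \<Longrightarrow> e \<noteq> e' \<Longrightarrow>
        open_segment (p (tail G e)) (p (head G e)) \<inter>
        open_segment (p (tail G e')) (p (head G e')) = {}"

definition skeleton :: "('v, 'e) pre_digraph \<Rightarrow> ('v \<Rightarrow> real^2) \<Rightarrow> (real^2) set" where
  "skeleton G p = p ` verts G \<union> (\<Union>e\<in>arcs G. closed_segment (p (tail G e)) (p (head G e)))"

text \<open>The unbounded component is the exterior face. As the graph is connected, adding the point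
  at infinity to it makes every face an open disc, so vertices, edges and faces form a cell
  decomposition of the sphere.\<close>

definition faces :: "('v, 'e) pre_digraph \<Rightarrow> ('v \<Rightarrow> real^2) \<Rightarrow> (real^2) set set" where
  "faces G p = components (- skeleton G p)"

definition rot90 :: "real^2 \<Rightarrow> real^2" where
  "rot90 x = vector [- x $ 2, x $ 1]"

text \<open>The face bordering the edge \<open>e\<close> on the side to which the normal vector \<open>n\<close> points. For a
  bridge, the two sides give the same face.\<close>

definition face_on_side ::
  "('v, 'e) pre_digraph \<Rightarrow> ('v \<Rightarrow> real^2) \<Rightarrow> real^2 \<Rightarrow> 'e \<Rightarrow> (real^2) set" where
  "face_on_side G p n e =
    (THE f. f \<in> faces G p \<and>
      (\<forall>x \<in> open_segment (p (tail G e)) (p (head G e)).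
        \<forall>\<^sub>F \<epsilon> in at_right 0. x + \<epsilon> *\<^sub>R n \<in> f))"

definition left_face :: "('v, 'e) pre_digraph \<Rightarrow> ('v \<Rightarrow> real^2) \<Rightarrow> 'e \<Rightarrow> (real^2) set" where
  "left_face G p e = face_on_side G p (rot90 (edge_vec G p e)) e"

definition right_face :: "('v, 'e) pre_digraph \<Rightarrow> ('v \<Rightarrow> real^2) \<Rightarrow> 'e \<Rightarrow> (real^2) set" where
  "right_face G p e = face_on_side G p (- rot90 (edge_vec G p e)) e"

context planar_truss
begin

lemma edge_vec_nonzero: "e \<in> arcs G \<Longrightarrow> edge_vec G p e \<noteq> 0"
  using inj_position no_loops[of e] by (auto simp: edge_vec_def inj_on_def)

lemma ex1_face_on_side:
  assumes e: "e \<in> arcs G" and n0: "n \<noteq> 0" and nd: "n \<bullet> edge_vec G p e = 0"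
  shows "\<exists>!f. f \<in> faces G p \<and>
      (\<forall>x \<in> open_segment (p (tail G e)) (p (head G e)).
        \<forall>\<^sub>F \<epsilon> in at_right 0. x + \<epsilon> *\<^sub>R n \<in> f)"
proof -
  define a b where "a = p (tail G e)" and "b = p (head G e)"
  define S where "S = open_segment a b"
  define P where "P f x \<longleftrightarrow> (\<forall>\<^sub>F \<epsilon> in at_right (0::real). x + \<epsilon> *\<^sub>R n \<in> f)" for f x
  define K where "K = p ` verts G \<union>
    (\<Union>e'\<in>arcs G - {e}. closed_segment (p (tail G e')) (p (head G e')))"
  have ab: "a \<noteq> b" using edge_vec_nonzero[OF e] by (auto simp: a_def b_def edge_vec_def)
  have nab: "n \<bullet> (b - a) = 0" using nd by (simp add: a_def b_def edge_vec_def)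
  have sk: "skeleton G p = K \<union> closed_segment a b"
    using e by (auto simp: skeleton_def K_def a_def b_def)
  have "compact (p ` verts G)"
    by (rule finite_imp_compact) simp
  moreover have "compact (\<Union>e'\<in>arcs G - {e}. closed_segment (p (tail G e')) (p (head G e')))"
    by (rule compact_UN) (simp_all add: compact_segment)
  ultimately have "compact K" unfolding K_def by (rule compact_Un)
  then have Kcl: "closed K" by (rule compact_imp_closed)
  have SK: "x \<notin> K" if x: "x \<in> S" for x
  proof
    assume "x \<in> K"
    then consider v where "v \<in> verts G" "x = p v"
      | e' where "e' \<in> arcs G" "e' \<noteq> e" "x \<in> closed_segment (p (tail G e')) (p (head G e'))"
      by (auto simp: K_def)
    then show False
    proof cases
      case 1
      then show False using vertex_not_in_edge[OF e] x by (auto simp: S_def a_def b_def)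
    next
      case 2
      then have "x \<notin> p ` verts G"
        using vertex_not_in_edge[OF e] x by (auto simp: S_def a_def b_def)
      then have "x \<in> open_segment (p (tail G e')) (p (head G e'))"
        using 2 by (auto simp: open_segment_def)
      then show False using edges_not_overlapping[OF e, of e'] 2 x
        by (auto simp: S_def a_def b_def)
    qed
  qed
  have perp: "n \<bullet> y = n \<bullet> a" if "y \<in> closed_segment a b" for y
  proof -
    from that obtain u where "y = (1 - u) *\<^sub>R a + u *\<^sub>R b" by (auto simp: in_segment)
    then have "y = a + u *\<^sub>R (b - a)" by (simp add: algebra_simps)
    then show ?thesis using nab by (simp add: inner_right_distrib)
  qed
  define H where "H x r = ball x r \<inter> {y. n \<bullet> y > n \<bullet> a}" for x r
  have Hex: "\<exists>r>0. H x r \<subseteq> - skeleton G p" if "x \<in> S" for x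
  proof -
    have "open (- K)" "x \<in> - K" using Kcl SK that by auto
    then obtain r where "r > 0" "ball x r \<subseteq> - K" by (meson open_contains_ball)
    moreover have "y \<notin> closed_segment a b" if "n \<bullet> y > n \<bullet> a" for y
      using perp[of y] that by force
    ultimately have "H x r \<subseteq> - skeleton G p" unfolding H_def sk by blast
    then show ?thesis using \<open>r > 0\<close> by blast
  qed
  have Hconn: "connected (H x r)" for x r unfolding H_def
    by (intro convex_connected convex_Int convex_ball convex_halfspace_gt)
  have Hev: "\<forall>\<^sub>F \<epsilon> in at_right (0::real). y + \<epsilon> *\<^sub>R n \<in> H x r"
    if "y \<in> S" "y \<in> ball x r" for x y r
  proof -
    have "((\<lambda>\<epsilon>. y + \<epsilon> *\<^sub>R n) \<longlongrightarrow> y + 0 *\<^sub>R n) (at_right (0::real))"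
      by (intro tendsto_intros)
    then have "\<forall>\<^sub>F \<epsilon> in at_right (0::real). y + \<epsilon> *\<^sub>R n \<in> ball x r"
      using that by (intro topological_tendstoD) auto
    moreover have "\<forall>\<^sub>F \<epsilon> in at_right (0::real). \<epsilon> > 0" by (rule eventually_at_right_less)
    ultimately show ?thesis
    proof eventually_elim
      case (elim \<epsilon>)
      have "n \<bullet> y = n \<bullet> a" using that by (intro perp) (auto simp: S_def open_segment_def)
      then show ?case using elim n0 by (auto simp: H_def inner_right_distrib)
    qed
  qed
  have step: "H x r \<subseteq> f"
    if "H x r \<subseteq> - skeleton G p" "f \<in> faces G p" "y \<in> S" "y \<in> ball x r" "P f y" for x y r f
  proof -
    have "\<forall>\<^sub>F \<epsilon> in at_right (0::real). y + \<epsilon> *\<^sub>R n \<in> H x r \<and> y + \<epsilon> *\<^sub>R n \<in> f"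
      using Hev[OF that(3,4)] that(5) unfolding P_def by (rule eventually_conj)
    then obtain \<epsilon> where "y + \<epsilon> *\<^sub>R n \<in> H x r \<and> y + \<epsilon> *\<^sub>R n \<in> f"
      using eventually_happens'[OF trivial_limit_at_right_real] by blast
    then have "f \<inter> H x r \<noteq> {}" by auto
    then show ?thesis
      using components_maximal[OF _ Hconn that(1)] that(2) by (auto simp: faces_def)
  qed
  define m where "m = midpoint a b"
  have m: "m \<in> S" using ab by (simp add: m_def S_def)
  obtain r where r: "r > 0" "H m r \<subseteq> - skeleton G p" using Hex[OF m] by blast
  have "\<forall>\<^sub>F \<epsilon> in at_right (0::real). m + \<epsilon> *\<^sub>R n \<in> H m r" using Hev[OF m] r by auto
  moreover from this obtain \<epsilon> where "m + \<epsilon> *\<^sub>R n \<in> H m r"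
    using eventually_happens'[OF trivial_limit_at_right_real] by blast
  then have "H m r \<noteq> {}" by auto
  then obtain f where f: "f \<in> faces G p" "H m r \<subseteq> f"
    using exists_component_superset[OF r(2) _ Hconn] r
    unfolding faces_def by (metis subset_empty)
  ultimately have Pm: "P f m" unfolding P_def by (auto elim: eventually_mono)
  have "P f x" if x: "x \<in> S" for x
  proof (rule connected_induction_simple[where S = S and P = "P f" and a = m])
    show "connected S" unfolding S_def by (rule convex_connected[OF convex_open_segment])
    fix y assume y: "y \<in> S"
    obtain s where s: "s > 0" "H y s \<subseteq> - skeleton G p" using Hex[OF y] by blast
    show "\<exists>T. openin (top_of_set S) T \<and> y \<in> T \<and> (\<forall>u\<in>T. \<forall>v\<in>T. P f u \<longrightarrow> P f v)"
    proof (intro exI[of _ "S \<inter> ball y s"] conjI ballI impI)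
      fix u v assume u: "u \<in> S \<inter> ball y s" "P f u" and v: "v \<in> S \<inter> ball y s"
      have "H y s \<subseteq> f" using step[OF s(2) f(1)] u by blast
      then show "P f v" using Hev[of v y s] v unfolding P_def
        by (auto elim: eventually_mono)
    qed (use y s in auto)
  qed (use m x Pm in auto)
  moreover have "g = f" if "g \<in> faces G p" "\<forall>x\<in>S. P g x" for g
  proof -
    have "\<forall>\<^sub>F \<epsilon> in at_right (0::real). m + \<epsilon> *\<^sub>R n \<in> f \<and> m + \<epsilon> *\<^sub>R n \<in> g"
      using Pm that m unfolding P_def by (auto intro: eventually_conj)
    then obtain \<epsilon> where "m + \<epsilon> *\<^sub>R n \<in> f \<and> m + \<epsilon> *\<^sub>R n \<in> g"
      using eventually_happens'[OF trivial_limit_at_right_real] by blast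
    then show ?thesis using components_nonoverlap[of f _ g] f(1) that(1) unfolding faces_def by blast
  qed
  ultimately have "\<exists>!f. f \<in> faces G p \<and> (\<forall>x\<in>S. P f x)" using f(1) by blast
  then show ?thesis by (simp add: S_def P_def a_def b_def)
qed

lemma inner_rot90_self: "rot90 x \<bullet> x = 0"
  by (simp add: rot90_def inner_vec_def sum_2)

lemma rot90_eq_0_iff: "rot90 x = 0 \<longleftrightarrow> x = 0"
  by (auto simp: rot90_def vec_eq_iff forall_2)

lemma left_face:
  assumes "e \<in> arcs G"
  shows "left_face G p e \<in> faces G p"
    and "x \<in> open_segment (p (tail G e)) (p (head G e)) \<Longrightarrow>
      \<forall>\<^sub>F \<epsilon> in at_right 0. x + \<epsilon> *\<^sub>R rot90 (edge_vec G p e) \<in> left_face G p e"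
proof -
  note * = theI'[OF ex1_face_on_side[OF assms, of "rot90 (edge_vec G p e)"],
      folded face_on_side_def left_face_def]
  show "left_face G p e \<in> faces G p"
    and "x \<in> open_segment (p (tail G e)) (p (head G e)) \<Longrightarrow>
      \<forall>\<^sub>F \<epsilon> in at_right 0. x + \<epsilon> *\<^sub>R rot90 (edge_vec G p e) \<in> left_face G p e"
    using * edge_vec_nonzero[OF assms] by (auto simp: rot90_eq_0_iff inner_rot90_self)
qed

lemma right_face:
  assumes "e \<in> arcs G"
  shows "right_face G p e \<in> faces G p"
    and "x \<in> open_segment (p (tail G e)) (p (head G e)) \<Longrightarrow>
      \<forall>\<^sub>F \<epsilon> in at_right 0. x + \<epsilon> *\<^sub>R - rot90 (edge_vec G p e) \<in> right_face G p e"
proof -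
  note * = theI'[OF ex1_face_on_side[OF assms, of "- rot90 (edge_vec G p e)"],
      folded face_on_side_def right_face_def]
  show "right_face G p e \<in> faces G p"
    and "x \<in> open_segment (p (tail G e)) (p (head G e)) \<Longrightarrow>
      \<forall>\<^sub>F \<epsilon> in at_right 0. x + \<epsilon> *\<^sub>R - rot90 (edge_vec G p e) \<in> right_face G p e"
    using * edge_vec_nonzero[OF assms] by (auto simp: rot90_eq_0_iff inner_rot90_self)
qed

end

section \<open>The position cosheaf and its homology\<close>

definition vec_group :: "'a::real_vector set \<Rightarrow> 'a monoid" where
  "vec_group S = \<lparr>carrier = S, monoid.mult = (+), one = 0\<rparr>"

lemma comm_group_vec_group: "subspace S \<Longrightarrow> comm_group (vec_group S)"
  by (intro comm_groupI)
    (auto simp: vec_group_def subspace_0 subspace_add algebra_simps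
      intro!: bexI[of _ "- x" for x] subspace_neg)

lemma comm_group_product_vec_group:
  assumes "\<And>i. i \<in> I \<Longrightarrow> subspace (S i)"
  shows "comm_group (product_group I (\<lambda>i. vec_group (S i)))"
proof -
  have "Group.group (product_group I (\<lambda>i. vec_group (S i)))"
    using assms by (simp add: comm_group_vec_group comm_group.axioms(2))
  then show ?thesis
    by (rule group.group_comm_groupI) (auto simp: vec_group_def add.commute)
qed

definition edge_stalk :: "('v, 'e) pre_digraph \<Rightarrow> ('v \<Rightarrow> real^2) \<Rightarrow> 'e \<Rightarrow> (real^2) set" where
  "edge_stalk G p e = (span {edge_vec G p e})\<^sup>\<bottom>"

definition perp_proj :: "'a::real_inner \<Rightarrow> 'a \<Rightarrow> 'a" where
  "perp_proj d x = x - ((x \<bullet> d) / (d \<bullet> d)) *\<^sub>R d"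

lemma mem_edge_stalk_iff: "x \<in> edge_stalk G p e \<longleftrightarrow> x \<bullet> edge_vec G p e = 0"
  by (auto simp: edge_stalk_def orthogonal_comp_def orthogonal_def span_singleton inner_commute
      intro: exI[of _ "1::real"])

lemma perp_proj_in_edge_stalk: "perp_proj (edge_vec G p e) x \<in> edge_stalk G p e"
  by (cases "edge_vec G p e = 0") (auto simp: mem_edge_stalk_iff perp_proj_def inner_diff_left)

text \<open>The index sets are finite, so direct products are direct sums. The stalks on vertices
  vanish, so degree 0 is trivial and every 1-chain is a cycle.\<close>

definition chains2 :: "('v, 'e) pre_digraph \<Rightarrow> ('v \<Rightarrow> real^2) \<Rightarrow> ((real^2) set \<Rightarrow> real^2) monoid" where
  "chains2 G p = product_group (faces G p) (\<lambda>f. vec_group UNIV)"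

definition chains1 :: "('v, 'e) pre_digraph \<Rightarrow> ('v \<Rightarrow> real^2) \<Rightarrow> ('e \<Rightarrow> real^2) monoid" where
  "chains1 G p = product_group (arcs G) (\<lambda>e. vec_group (edge_stalk G p e))"

definition boundary ::
  "('v, 'e) pre_digraph \<Rightarrow> ('v \<Rightarrow> real^2) \<Rightarrow> ((real^2) set \<Rightarrow> real^2) \<Rightarrow> 'e \<Rightarrow> real^2" where
  "boundary G p \<eta> = (\<lambda>e\<in>arcs G.
    perp_proj (edge_vec G p e) (\<eta> (left_face G p e) - \<eta> (right_face G p e)))"

definition H2 :: "('v, 'e) pre_digraph \<Rightarrow> ('v \<Rightarrow> real^2) \<Rightarrow> ((real^2) set \<Rightarrow> real^2) set" where
  "H2 G p = kernel (chains2 G p) (chains1 G p) (boundary G p)"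

definition H1 :: "('v, 'e) pre_digraph \<Rightarrow> ('v \<Rightarrow> real^2) \<Rightarrow> ('e \<Rightarrow> real^2) set monoid" where
  "H1 G p = chains1 G p Mod (boundary G p ` carrier (chains2 G p))"

definition H1_class ::
  "('v, 'e) pre_digraph \<Rightarrow> ('v \<Rightarrow> real^2) \<Rightarrow> ('e \<Rightarrow> real^2) \<Rightarrow> ('e \<Rightarrow> real^2) set" where
  "H1_class G p \<rho> = (boundary G p ` carrier (chains2 G p)) #>\<^bsub>chains1 G p\<^esub> \<rho>"

lemma comm_group_chains1: "comm_group (chains1 G p)"
  unfolding chains1_def
  by (intro comm_group_product_vec_group) (simp add: edge_stalk_def subspace_orthogonal_comp)

lemma comm_group_chains2: "comm_group (chains2 G p)"
  unfolding chains2_def by (intro comm_group_product_vec_group subspace_UNIV)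

lemma (in planar_truss) group_hom_boundary: "group_hom (chains2 G p) (chains1 G p) (boundary G p)"
proof -
  have "boundary G p \<in> hom (chains2 G p) (chains1 G p)"
  proof (rule homI)
    fix x
    show "boundary G p x \<in> carrier (chains1 G p)"
      by (auto simp: chains1_def boundary_def vec_group_def perp_proj_in_edge_stalk)
  next
    fix x y
    show "boundary G p (x \<otimes>\<^bsub>chains2 G p\<^esub> y) = boundary G p x \<otimes>\<^bsub>chains1 G p\<^esub> boundary G p y"
      by (rule ext)
        (simp add: chains1_def chains2_def boundary_def vec_group_def perp_proj_def restrict_def
          left_face right_face inner_simps add_divide_distrib diff_divide_distrib algebra_simps)
  qed
  then show ?thesis
    by (simp add: group_hom_def group_hom_axioms_def comm_group.axioms(2) comm_group_chains1
        comm_group_chains2)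
qed

lemma (in planar_truss) group_H1: "Group.group (H1 G p)"
proof -
  interpret comm_group "chains1 G p" by (rule comm_group_chains1)
  interpret group_hom "chains2 G p" "chains1 G p" "boundary G p" by (rule group_hom_boundary)
  show ?thesis unfolding H1_def
    by (intro normal.factorgroup_is_group subgroup_imp_normal img_is_subgroup)
qed

text \<open>A 2-cycle is the same as a parallel dual realization.\<close>

lemma (in planar_truss) H2_iff_parallel:
  "\<xi> \<in> H2 G p \<longleftrightarrow> \<xi> \<in> extensional (faces G p) \<and>
    (\<forall>e\<in>arcs G. \<exists>c. \<xi> (left_face G p e) - \<xi> (right_face G p e) = c *\<^sub>R edge_vec G p e)"
proof -
  have *: "perp_proj d x = 0 \<longleftrightarrow> (\<exists>c. x = c *\<^sub>R d)" if "d \<noteq> 0" for d x :: "real^2"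
  proof
    assume "perp_proj d x = 0"
    then show "\<exists>c. x = c *\<^sub>R d" unfolding perp_proj_def right_minus_eq by blast
  next
    assume "\<exists>c. x = c *\<^sub>R d"
    then obtain c where "x = c *\<^sub>R d" by blast
    then show "perp_proj d x = 0" using that by (simp add: perp_proj_def)
  qed
  have "\<xi> \<in> H2 G p \<longleftrightarrow> \<xi> \<in> extensional (faces G p) \<and>
    (\<forall>e\<in>arcs G. perp_proj (edge_vec G p e) (\<xi> (left_face G p e) - \<xi> (right_face G p e)) = 0)"
    by (auto simp: H2_def kernel_def chains1_def chains2_def vec_group_def boundary_def
        PiE_def fun_eq_iff restrict_def)
  then show ?thesis using * edge_vec_nonzero by simp
qed

section \<open>Infinitesimal motions\<close>

definition preserves_lengths :: "('v, 'e) pre_digraph \<Rightarrow> ('v \<Rightarrow> real^2) \<Rightarrow> ('v \<Rightarrow> real^2) \<Rightarrow> bool" where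
  "preserves_lengths G p w \<longleftrightarrow>
    (\<forall>e\<in>arcs G. (w (head G e) - w (tail G e)) \<bullet> edge_vec G p e = 0)"

definition global_translation :: "('v, 'e) pre_digraph \<Rightarrow> ('v \<Rightarrow> real^2) \<Rightarrow> bool" where
  "global_translation G w \<longleftrightarrow> (\<exists>b. \<forall>v\<in>verts G. w v = b)"

definition global_rotation :: "('v, 'e) pre_digraph \<Rightarrow> ('v \<Rightarrow> real^2) \<Rightarrow> ('v \<Rightarrow> real^2) \<Rightarrow> bool" where
  "global_rotation G p w \<longleftrightarrow>
    (\<exists>c b. c \<noteq> 0 \<and> (\<forall>v\<in>verts G. w v = c *\<^sub>R rot90 (p v) + b)) \<and>
    \<not> (\<exists>b. \<forall>v\<in>verts G. w v = b)"

definition mechanism :: "('v, 'e) pre_digraph \<Rightarrow> ('v \<Rightarrow> real^2) \<Rightarrow> ('v \<Rightarrow> real^2) \<Rightarrow> bool" where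
  "mechanism G p w \<longleftrightarrow>
    preserves_lengths G p w \<and> \<not> (\<exists>c b. \<forall>v\<in>verts G. w v = c *\<^sub>R rot90 (p v) + b)"

lemma not_translation_iff:
  assumes "preserves_lengths G p w"
  shows "\<not> global_translation G w \<longleftrightarrow> mechanism G p w \<or> global_rotation G p w"
proof
  assume nt: "\<not> global_translation G w"
  show "mechanism G p w \<or> global_rotation G p w"
  proof (rule disjCI)
    assume "\<not> global_rotation G p w"
    then have "c = 0" if "\<forall>v\<in>verts G. w v = c *\<^sub>R rot90 (p v) + b" for c b
      using nt that by (auto simp: global_rotation_def global_translation_def)
    then show "mechanism G p w"
      using nt assms unfolding mechanism_def global_translation_def
      by (metis add_0 scaleR_zero_left)
  qed
next
  assume *: "mechanism G p w \<or> global_rotation G p w"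
  show "\<not> global_translation G w"
  proof
    assume "global_translation G w"
    then obtain b where "\<forall>v\<in>verts G. w v = 0 *\<^sub>R rot90 (p v) + b"
      by (auto simp: global_translation_def)
    with * \<open>global_translation G w\<close> show False
      unfolding mechanism_def global_rotation_def global_translation_def by blast
  qed
qed

definition edge_rotations :: "('v, 'e) pre_digraph \<Rightarrow> ('v \<Rightarrow> real^2) \<Rightarrow> 'e \<Rightarrow> real^2" where
  "edge_rotations G w = (\<lambda>e\<in>arcs G. w (head G e) - w (tail G e))"

lemma edge_rotations_in_chains1:
  "preserves_lengths G p w \<Longrightarrow> edge_rotations G w \<in> carrier (chains1 G p)"
  by (auto simp: preserves_lengths_def edge_rotations_def chains1_def vec_group_def
      mem_edge_stalk_iff)

end

theory Submission
  imports Defs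
begin

text \<open>Suppose that the edge rotations \<open>\<rho>\<close> of \<open>w\<close> are the perpendicular parts of the relative
  displacements \<open>\<delta> e = \<eta> (l e) - \<eta> (r e)\<close> of the dual edges. Then \<open>\<delta> e\<close> and \<open>\<rho> e\<close> differ by a
  multiple of the edge vector, and \<open>\<rho> e\<close> is perpendicular to the edge, so
  \<open>\<delta> e \<bullet> \<rho> e = \<rho> e \<bullet> \<rho> e\<close> and \<open>\<Sum> \<delta> e \<bullet> \<rho> e = \<Sum> \<bar>\<rho> e\<bar>\<^sup>2\<close>.

  On the other hand the sum \<open>\<Sum> \<delta> e \<bullet> \<rho> e\<close> is zero for every \<open>\<eta>\<close> and \<open>w\<close>
  (\<open>face_differences_orthogonal_to_vertex_differences\<close>): \<open>\<delta>\<close> is a cellular boundary and \<open>\<rho>\<close> a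
  coboundary, and these are orthogonal because \<open>\<partial>\<partial> = 0\<close>. Hence all edge rotations vanish, and
  \<open>w\<close> is constant on the connected graph, that is, a translation.

  The relation \<open>\<partial>\<partial> = 0\<close> is a local statement at each vertex
  (\<open>sum_around_vertex\<close>): the values of \<open>\<eta>\<close> met on a circuit around the vertex return to where they
  started, so their jumps across the incident edges cancel. The circuit is a circle so small that
  it meets only these edges, each of them once. The face containing the moving point is then
  a step function of the angle, whose jumps telescope (\<open>sum_jumps\<close>). This avoids both ordering
  the edges around the vertex and the separation theorems of plane topology.\<close>

section \<open>Jumps of step functions\<close>

text \<open>Subtracting from \<open>F\<close> the jumps passed so far leaves a locally constant function, which is
  constant on the interval. The values of \<open>F\<close> at the jump points do not matter.\<close>

lemma sum_jumps:
  fixes F L R :: "real \<Rightarrow> 'a::ab_group_add"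
  assumes "a \<le> b" and "finite T" and "T \<subseteq> {a<..<b}"
    and off: "\<And>t. t \<in> {a..b} - T \<Longrightarrow> \<forall>\<^sub>F s in at t. F s = F t"
    and left: "\<And>t. t \<in> T \<Longrightarrow> \<forall>\<^sub>F s in at_left t. F s = L t"
    and right: "\<And>t. t \<in> T \<Longrightarrow> \<forall>\<^sub>F s in at_right t. F s = R t"
  shows "(\<Sum>t\<in>T. R t - L t) = F b - F a"
proof -
  define J where "J s = (\<Sum>t\<in>{t\<in>T. t < s}. R t - L t)" for s
  \<comment> \<open>At a jump point \<open>H\<close> continues \<open>F\<close> from the left, as \<open>J\<close> does not count that jump yet.\<close>
  define H where "H s = (if s \<in> T then L s else F s) - J s" for s
  have isolated: "\<forall>\<^sub>F s in at t. s \<notin> T \<and> (\<forall>t'\<in>T. t' \<noteq> t \<longrightarrow> (t' < s \<longleftrightarrow> t' < t))" for t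
  proof -
    have "open (- (T - {t}))" "t \<in> - (T - {t})"
      using \<open>finite T\<close> by (auto simp del: Compl_Diff_eq intro!: open_Compl finite_imp_closed)
    then obtain d where d: "d > 0" "ball t d \<subseteq> - (T - {t})" by (meson open_contains_ball)
    have "\<forall>\<^sub>F s in at t. s \<noteq> t \<and> dist s t < d"
      unfolding eventually_at using d(1) by (auto simp: dist_commute)
    then show ?thesis
    proof eventually_elim
      case (elim s)
      have *: "d \<le> \<bar>t - t'\<bar>" if "t' \<in> T" "t' \<noteq> t" for t'
    proof (rule ccontr)
      assume "\<not> d \<le> \<bar>t - t'\<bar>"
      then have "t' \<in> ball t d" by (simp add: dist_real_def)
      then show False using d(2) that by blast
    qed
      have "s \<notin> T" using *[of s] elim by (auto simp: dist_real_def)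
      moreover have "t' < s \<longleftrightarrow> t' < t" if "t' \<in> T" "t' \<noteq> t" for t'
        using *[OF that] elim by (auto simp: dist_real_def)
      ultimately show ?case by blast
    qed
  qed
  have "H a = H b"
  proof (rule connected_local_const[where A = "{a..b}"])
    show "\<forall>t\<in>{a..b}. \<forall>\<^sub>F s in at t within {a..b}. H t = H s"
    proof
      fix t assume t: "t \<in> {a..b}"
      have "\<forall>\<^sub>F s in at t. H t = H s"
      proof (cases "t \<in> T")
        case False
        then have "\<forall>\<^sub>F s in at t. F s = F t" using off t by blast
        then show ?thesis using isolated[of t]
        proof eventually_elim
          case (elim s)
          then have "{t'\<in>T. t' < s} = {t'\<in>T. t' < t}" using False by (metis (full_types))
          then show ?case using elim False by (simp add: H_def J_def)
        qed
      next
        case True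
        have i: "\<forall>\<^sub>F s in at t within A. s \<notin> T \<and> (\<forall>t'\<in>T. t' \<noteq> t \<longrightarrow> (t' < s \<longleftrightarrow> t' < t))" for A
          using isolated by (rule filter_leD[OF at_le, rotated]) simp
        have "\<forall>\<^sub>F s in at_left t. s < t" by (simp add: eventually_at_filter)
        then have "\<forall>\<^sub>F s in at_left t. H t = H s" using left[OF True] i[of "{..<t}"]
        proof eventually_elim
          case (elim s)
          then have "{t'\<in>T. t' < s} = {t'\<in>T. t' < t}" by auto
          then show ?case using elim True by (simp add: H_def J_def)
        qed
        moreover
        have "\<forall>\<^sub>F s in at_right t. s > t" by (simp add: eventually_at_filter)
        then have "\<forall>\<^sub>F s in at_right t. H t = H s" using right[OF True] i[of "{t<..}"]
        proof eventually_elim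
          case (elim s)
          then have "{t'\<in>T. t' < s} = insert t {t'\<in>T. t' < t}" using True by auto
          then have "J s = (R t - L t) + J t" using \<open>finite T\<close> by (simp add: J_def)
          then show ?case using elim True by (simp add: H_def)
        qed
        ultimately show ?thesis by (simp add: eventually_at_split)
      qed
      then show "\<forall>\<^sub>F s in at t within {a..b}. H t = H s"
        by (rule filter_leD[OF at_le, rotated]) simp
    qed
  qed (use \<open>a \<le> b\<close> in auto)
  moreover have "{t\<in>T. t < a} = {}" "{t\<in>T. t < b} = T" "a \<notin> T" "b \<notin> T"
    using \<open>T \<subseteq> {a<..<b}\<close> by auto
  ultimately show ?thesis by (simp add: H_def J_def)
qed

section \<open>The unit circle\<close>

definition unit_vec :: "real \<Rightarrow> real^2" where
  "unit_vec t = vector [cos t, sin t]"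

lemma unit_vec_inner: "unit_vec s \<bullet> unit_vec t = cos (t - s)"
  by (simp add: unit_vec_def inner_vec_def sum_2 cos_diff algebra_simps)

lemma rot90_unit_vec_inner: "rot90 (unit_vec s) \<bullet> unit_vec t = sin (t - s)"
  by (simp add: unit_vec_def rot90_def inner_vec_def sum_2 sin_diff algebra_simps)

lemma norm_unit_vec: "norm (unit_vec t) = 1"
  by (simp add: norm_eq_sqrt_inner unit_vec_inner)

lemma continuous_unit_vec: "isCont unit_vec t"
proof -
  have "\<forall>i. ((\<lambda>s. unit_vec s $ i) \<longlongrightarrow> unit_vec t $ i) (at t)"
    by (auto simp: forall_2 unit_vec_def intro!: tendsto_intros)
  then show ?thesis unfolding isCont_def by (intro vec_tendstoI) simp
qed

lemma unit_vec_periodic: "unit_vec (t + 2 * pi) = unit_vec t"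
  by (simp add: unit_vec_def)

lemma unit_vec_eq_imp:
  assumes "unit_vec s = unit_vec t" and "\<bar>s - t\<bar> < 2 * pi"
  shows "s = t"
proof -
  have "cos (t - s) = 1" using unit_vec_inner[of s t] unit_vec_inner[of s s] assms(1) by simp
  then obtain n :: int where n: "t - s = n * 2 * pi" by (auto simp: cos_one_2pi_int)
  have "\<bar>real_of_int n\<bar> * (2 * pi) = \<bar>t - s\<bar>" unfolding n by (simp add: abs_mult)
  also have "\<dots> < 1 * (2 * pi)" using assms(2) by (simp add: abs_minus_commute)
  finally have "\<bar>real_of_int n\<bar> < 1" by (rule mult_right_less_imp_less) simp
  then have "n = 0" by linarith
  then show ?thesis using n by simp
qed

lemma polar_form:
  fixes u :: "real^2"
  obtains t where "0 \<le> t" "t < 2 * pi" "u = norm u *\<^sub>R unit_vec t"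
proof (cases "u = 0")
  case True
  then show ?thesis using that[of 0] by simp
next
  case False
  have "(norm u)\<^sup>2 = (u $ 1)\<^sup>2 + (u $ 2)\<^sup>2"
    by (simp only: power2_norm_eq_inner inner_vec_def sum_2) (simp add: power2_eq_square)
  moreover have "(norm u)\<^sup>2 \<noteq> 0" using False by simp
  ultimately have "(u $ 1 / norm u)\<^sup>2 + (u $ 2 / norm u)\<^sup>2 = 1"
    by (metis add_divide_distrib divide_self power_divide)
  then obtain t where t: "0 \<le> t" "t < 2 * pi" "u $ 1 / norm u = cos t" "u $ 2 / norm u = sin t"
    by (rule sincos_total_2pi)
  have "u = norm u *\<^sub>R unit_vec t"
    using False by (simp add: vec_eq_iff forall_2 unit_vec_def t(3,4)[symmetric])
  then show ?thesis using that t by blast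
qed

lemma rot90_scaleR: "rot90 (c *\<^sub>R x) = c *\<^sub>R rot90 x"
  by (simp add: rot90_def vec_eq_iff forall_2)

lemma rot90_minus: "rot90 (- x) = - rot90 x"
  by (simp add: rot90_def vec_eq_iff forall_2)

section \<open>Faces around an edge and around a vertex\<close>

lemma connected_component_set_of_member:
  assumes "f \<in> components S" and "x \<in> f"
  shows "connected_component_set S x = f"
proof -
  obtain y where "f = connected_component_set S y" using assms(1) by (auto simp: components_iff)
  then show ?thesis using connected_component_eq[of x S y] assms(2) by simp
qed

text \<open>The edges at a vertex \<open>v\<close> are regarded as pointing away from \<open>v\<close>, whatever their
  orientation, so that "counterclockwise around \<open>v\<close>" means the same for all of them.\<close>

definition other_end :: "('v, 'e) pre_digraph \<Rightarrow> 'v \<Rightarrow> 'e \<Rightarrow> 'v" where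
  "other_end G v e = (if tail G e = v then head G e else tail G e)"

definition spoke :: "('v, 'e) pre_digraph \<Rightarrow> ('v \<Rightarrow> real^2) \<Rightarrow> 'v \<Rightarrow> 'e \<Rightarrow> real^2" where
  "spoke G p v e = p (other_end G v e) - p v"

context planar_truss
begin

lemma closed_subskeleton:
  assumes "A \<subseteq> verts G" and "B \<subseteq> arcs G"
  shows "closed (p ` A \<union> (\<Union>e\<in>B. closed_segment (p (tail G e)) (p (head G e))))"
  using assms
  by (intro closed_Un closed_UN finite_imp_closed finite_imageI closed_segment)
    (auto intro: finite_subset)

lemma open_face: "f \<in> faces G p \<Longrightarrow> open f"
  using closed_subskeleton[of "verts G" "arcs G"] open_components[of "- skeleton G p" f]
  unfolding faces_def skeleton_def by (simp add: open_closed)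

text \<open>The face beside an edge is given by points on the normals to the edge only. A circle around
  an endpoint crosses the edge along no such normal; what it needs is that the whole of one side
  of a small disc lies in that face. The half disc avoids the skeleton and is connected.\<close>

lemma half_disc_in_face:
  assumes e: "e \<in> arcs G" and n0: "n \<noteq> 0" and nd: "n \<bullet> edge_vec G p e = 0"
    and x: "x \<in> open_segment (p (tail G e)) (p (head G e))"
  obtains r where "r > 0" and "ball x r \<inter> {y. n \<bullet> y > n \<bullet> x} \<subseteq> face_on_side G p n e"
    and "face_on_side G p n e \<in> faces G p"
proof -
  let ?ab = "closed_segment (p (tail G e)) (p (head G e))"
  define K where "K = p ` verts G \<union>
    (\<Union>e'\<in>arcs G - {e}. closed_segment (p (tail G e')) (p (head G e')))"
  have sk: "skeleton G p = K \<union> ?ab" using e by (auto simp: skeleton_def K_def)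
  have "x \<notin> p ` verts G" using vertex_not_in_edge[OF e] x by auto
  moreover have "x \<notin> closed_segment (p (tail G e')) (p (head G e'))"
    if "e' \<in> arcs G" "e' \<noteq> e" for e'
    using edges_not_overlapping[OF e, of e'] \<open>x \<notin> p ` verts G\<close> that x
    by (auto simp: open_segment_def)
  ultimately have "x \<in> - K" by (auto simp: K_def)
  moreover have "open (- K)" unfolding K_def by (intro open_Compl closed_subskeleton) auto
  ultimately obtain r where r: "r > 0" "ball x r \<subseteq> - K" by (meson open_contains_ball)
  define H where "H = ball x r \<inter> {y. n \<bullet> y > n \<bullet> x}"
  have const: "n \<bullet> y = n \<bullet> p (tail G e)" if "y \<in> ?ab" for y
  proof -
    from that obtain u where "y = (1 - u) *\<^sub>R p (tail G e) + u *\<^sub>R p (head G e)"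
      by (auto simp: in_segment)
    then have "y = p (tail G e) + u *\<^sub>R edge_vec G p e" by (simp add: edge_vec_def algebra_simps)
    then show ?thesis using nd by (simp add: inner_right_distrib)
  qed
  have "x \<in> ?ab" using x by (simp add: open_segment_def)
  then have "z \<notin> ?ab" if "n \<bullet> z > n \<bullet> x" for z
    using const[of z] const[of x] that by auto
  then have "H \<subseteq> - skeleton G p"
    using r(2) unfolding H_def sk by blast
  moreover have "connected H" unfolding H_def
    by (intro convex_connected convex_Int convex_ball convex_halfspace_gt)
  moreover have face: "face_on_side G p n e \<in> faces G p"
    and side: "\<forall>\<^sub>F \<epsilon> in at_right 0. x + \<epsilon> *\<^sub>R n \<in> face_on_side G p n e"
    using theI'[OF ex1_face_on_side[OF e n0 nd], folded face_on_side_def] x by auto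
  moreover have "face_on_side G p n e \<inter> H \<noteq> {}"
  proof -
    have "((\<lambda>\<epsilon>. x + \<epsilon> *\<^sub>R n) \<longlongrightarrow> x + 0 *\<^sub>R n) (at_right (0::real))"
      by (intro tendsto_intros)
    then have "\<forall>\<^sub>F \<epsilon> in at_right (0::real). x + \<epsilon> *\<^sub>R n \<in> ball x r"
      using r by (intro topological_tendstoD) auto
    moreover have "\<forall>\<^sub>F \<epsilon> in at_right (0::real). \<epsilon> > 0" by (rule eventually_at_right_less)
    ultimately have "\<forall>\<^sub>F \<epsilon> in at_right (0::real). x + \<epsilon> *\<^sub>R n \<in> face_on_side G p n e \<inter> H"
      using side
      by eventually_elim (use n0 in \<open>auto simp: H_def inner_right_distrib\<close>)
    then show ?thesis using eventually_happens'[OF trivial_limit_at_right_real] by blast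
  qed
  ultimately have "H \<subseteq> face_on_side G p n e"
    using components_maximal[of "face_on_side G p n e" "- skeleton G p" H] by (simp add: faces_def)
  then show ?thesis using that[OF r(1) _ face] unfolding H_def by blast
qed

text \<open>On a circuit counterclockwise around \<open>v\<close>, an outgoing edge is crossed from its right to
  its left face and an incoming edge from left to right. So the claim says that the total jump of
  \<open>g\<close> on the circuit is zero.\<close>

lemma sum_around_vertex:
  fixes g :: "(real^2) set \<Rightarrow> 'a::ab_group_add"
  assumes v: "v \<in> verts G"
  shows "(\<Sum>e\<in>in_arcs G v. g (left_face G p e) - g (right_face G p e)) =
    (\<Sum>e\<in>out_arcs G v. g (left_face G p e) - g (right_face G p e))"
proof -
  define I where "I = in_arcs G v \<union> out_arcs G v"
  define u where "u = spoke G p v"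
  \<comment> \<open>The part of the skeleton that a small circle around \<open>p v\<close> has to avoid.\<close>
  define K where "K = p ` (verts G - {v}) \<union>
    (\<Union>e\<in>arcs G - I. closed_segment (p (tail G e)) (p (head G e)))"
  have fin: "finite I" by (rule finite_subset[of _ "arcs G"]) (auto simp: I_def)
  have arcsI: "e \<in> arcs G" if "e \<in> I" for e using that by (auto simp: I_def)
  have seg: "closed_segment (p (tail G e)) (p (head G e)) = closed_segment (p v) (p v + u e)"
      "open_segment (p (tail G e)) (p (head G e)) = open_segment (p v) (p v + u e)"
    if "e \<in> I" for e
  proof -
    have "tail G e = v \<and> p (head G e) = p v + u e \<or> head G e = v \<and> p (tail G e) = p v + u e"
      using that by (auto simp: I_def u_def spoke_def other_end_def)
    then show "closed_segment (p (tail G e)) (p (head G e)) = closed_segment (p v) (p v + u e)"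
      and "open_segment (p (tail G e)) (p (head G e)) = open_segment (p v) (p v + u e)"
      using closed_segment_commute open_segment_commute by metis+
  qed
  have out: "u e = edge_vec G p e" if "e \<in> out_arcs G v" for e
    using that by (auto simp: u_def spoke_def other_end_def edge_vec_def)
  have inn: "u e = - edge_vec G p e" if "e \<in> in_arcs G v" for e
    using that no_loops[of e] by (auto simp: u_def spoke_def other_end_def edge_vec_def)
  have u0: "u e \<noteq> 0" if "e \<in> I" for e
    using that out inn edge_vec_nonzero[of e] by (auto simp: I_def)
  have "p v \<notin> K"
  proof
    assume "p v \<in> K"
    moreover have "p v \<notin> p ` (verts G - {v})"
      using inj_position v by (auto simp: inj_on_def)
    ultimately obtain e where e: "e \<in> arcs G" "e \<notin> I"
      and "p v \<in> closed_segment (p (tail G e)) (p (head G e))" by (auto simp: K_def)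
    then have "p v = p (tail G e) \<or> p v = p (head G e)"
      using vertex_not_in_edge[OF e(1) v] by (auto simp: open_segment_def)
    then have "v = tail G e \<or> v = head G e"
      using inj_onD[OF inj_position _ v, of "tail G e"] inj_onD[OF inj_position _ v, of "head G e"]
        e(1) by auto
    then show False using e by (auto simp: I_def)
  qed
  moreover have "closed K" unfolding K_def by (intro closed_subskeleton) auto
  ultimately obtain r where r: "r > 0" "ball (p v) r \<subseteq> - K"
    by (metis ComplI open_Compl open_contains_ball)
  have long: "r \<le> norm (u e)" if "e \<in> I" for e
  proof (rule ccontr)
    assume "\<not> r \<le> norm (u e)"
    then have "p v + u e \<in> ball (p v) r" by (simp add: dist_norm)
    moreover have "p v + u e \<in> p ` (verts G - {v})"
      using that no_loops[of e]
      by (auto simp: I_def u_def spoke_def other_end_def)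
    ultimately show False using r(2) by (auto simp: K_def)
  qed
  define \<alpha> where "\<alpha> e = (SOME t. 0 \<le> t \<and> t < 2 * pi \<and> u e = norm (u e) *\<^sub>R unit_vec t)" for e
  have \<alpha>: "0 \<le> \<alpha> e" "\<alpha> e < 2 * pi" "u e = norm (u e) *\<^sub>R unit_vec (\<alpha> e)" for e
    using someI_ex[of "\<lambda>t. 0 \<le> t \<and> t < 2 * pi \<and> u e = norm (u e) *\<^sub>R unit_vec t"]
      polar_form[of "u e"] unfolding \<alpha>_def by metis+
  \<comment> \<open>The edges at \<open>v\<close> have length at least \<open>r\<close>, since their other ends are in \<open>K\<close>; radius
    \<open>r / 2\<close> puts the crossing points in the interior of the edges.\<close>
  define c where "c t = p v + (r / 2) *\<^sub>R unit_vec t" for t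
  have on_edge: "c (\<alpha> e) \<in> open_segment (p (tail G e)) (p (head G e))" if "e \<in> I" for e
  proof -
    define s where "s = r / 2 / norm (u e)"
    have s: "0 < s" "s < 1" using r(1) long[OF that] u0[OF that] by (auto simp: s_def)
    have "s *\<^sub>R u e = (r / 2) *\<^sub>R unit_vec (\<alpha> e)"
      using u0[OF that] by (subst \<alpha>(3)) (simp add: s_def)
    then have "c (\<alpha> e) = (1 - s) *\<^sub>R p v + s *\<^sub>R (p v + u e)" by (simp add: c_def algebra_simps)
    then show ?thesis using s u0[OF that] unfolding seg(2)[OF that] in_segment by auto
  qed
  have inj: "inj_on \<alpha> I"
  proof (rule inj_onI)
    fix e e' assume *: "e \<in> I" "e' \<in> I" "\<alpha> e = \<alpha> e'"
    then have "c (\<alpha> e) \<in> open_segment (p (tail G e)) (p (head G e)) \<inter>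
        open_segment (p (tail G e')) (p (head G e'))"
      using on_edge[of e] on_edge[of e'] by simp
    then show "e = e'" using edges_not_overlapping[of e e'] arcsI * by auto
  qed
  have hit: "\<exists>e\<in>I. unit_vec t = unit_vec (\<alpha> e)" if "c t \<in> skeleton G p" for t
  proof -
    have "dist (p v) (c t) = r / 2" using r(1) by (simp add: c_def dist_norm norm_unit_vec)
    then have "c t \<notin> K" "c t \<noteq> p v" using r by (auto simp: subset_iff)
    with that obtain e where e: "e \<in> I" "c t \<in> closed_segment (p (tail G e)) (p (head G e))"
      by (auto simp: skeleton_def K_def)
    then obtain s where s: "0 \<le> s" "c t = (1 - s) *\<^sub>R p v + s *\<^sub>R (p v + u e)"
      unfolding seg(1)[OF e(1)] in_segment by auto
    then have "(r / 2) *\<^sub>R unit_vec t = s *\<^sub>R u e" by (simp add: c_def algebra_simps)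
    also have "\<dots> = (s * norm (u e)) *\<^sub>R unit_vec (\<alpha> e)" by (subst \<alpha>(3)) simp
    finally have eq: "(r / 2) *\<^sub>R unit_vec t = (s * norm (u e)) *\<^sub>R unit_vec (\<alpha> e)" .
    then have "norm ((r / 2) *\<^sub>R unit_vec t) = norm ((s * norm (u e)) *\<^sub>R unit_vec (\<alpha> e))"
      by simp
    then have "r / 2 = s * norm (u e)" using r(1) s(1) by (simp add: norm_unit_vec)
    then have "unit_vec t = unit_vec (\<alpha> e)"
      using eq r(1) by (metis half_gt_zero less_numeral_extra(3) scaleR_left_imp_eq)
    then show ?thesis using e(1) by blast
  qed
  define F where "F t = g (connected_component_set (- skeleton G p) (c t))" for t
  have F_face: "F t = g f" if "f \<in> faces G p" "c t \<in> f" for t f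
    using connected_component_set_of_member that by (auto simp: F_def faces_def)
  have cont_c: "isCont c t" for t
    unfolding c_def by (intro continuous_intros continuous_unit_vec)
  have F_const: "\<forall>\<^sub>F s in at t. F s = F t" if "c t \<notin> skeleton G p" for t
  proof -
    have "\<Union> (faces G p) = - skeleton G p" unfolding faces_def by (metis Union_components)
    then have "c t \<in> \<Union> (faces G p)" using that by blast
    then obtain f where f: "f \<in> faces G p" "c t \<in> f" by blast
    have "\<forall>\<^sub>F s in at t. c s \<in> f"
      using cont_c open_face[OF f(1)] f(2) unfolding isCont_def by (rule topological_tendstoD)
    then show ?thesis by eventually_elim (use F_face[OF f(1)] f(2) in simp)
  qed
  \<comment> \<open>Both sides of an edge at once: \<open>\<sigma> = 1\<close> is the counterclockwise side, \<open>\<sigma> = - 1\<close> the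
    clockwise one. The signed distance of \<open>c s\<close> from the line of the edge has the sign of \<open>sin (s - \<alpha> e)\<close>.\<close>
  have one_sided: "\<forall>\<^sub>F s in at (\<alpha> e). 0 < \<sigma> * sin (s - \<alpha> e) \<longrightarrow>
      F s = g (face_on_side G p (\<sigma> *\<^sub>R rot90 (u e)) e)" if eI: "e \<in> I" and \<sigma>: "\<sigma> \<noteq> 0" for e \<sigma>
  proof -
    let ?n = "\<sigma> *\<^sub>R rot90 (u e)"
    have "u e = edge_vec G p e \<or> u e = - edge_vec G p e" using eI out inn by (auto simp: I_def)
    then have "?n \<bullet> edge_vec G p e = 0"
      by (auto simp: rot90_minus inner_rot90_self)
    moreover have n0: "?n \<noteq> 0" using \<sigma> u0[OF eI] by (simp add: rot90_eq_0_iff)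
    ultimately obtain d where d: "d > 0"
      and sub: "ball (c (\<alpha> e)) d \<inter> {y. ?n \<bullet> y > ?n \<bullet> c (\<alpha> e)} \<subseteq> face_on_side G p ?n e"
      and f: "face_on_side G p ?n e \<in> faces G p"
      using half_disc_in_face[OF arcsI[OF eI] _ _ on_edge[OF eI]] by blast
    have normal: "rot90 (u e) = norm (u e) *\<^sub>R rot90 (unit_vec (\<alpha> e))"
      using \<alpha>(3) rot90_scaleR by metis
    have "\<forall>\<^sub>F s in at (\<alpha> e). c s \<in> ball (c (\<alpha> e)) d"
      using cont_c unfolding isCont_def by (rule topological_tendstoD) (use d in auto)
    then show ?thesis
    proof eventually_elim
      case (elim s)
      have "?n \<bullet> c s = ?n \<bullet> p v + (norm (u e) * (r / 2)) * (\<sigma> * sin (s - \<alpha> e))" for s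
        by (simp add: normal c_def inner_right_distrib rot90_unit_vec_inner algebra_simps)
      then have "?n \<bullet> c s > ?n \<bullet> c (\<alpha> e)" if "0 < \<sigma> * sin (s - \<alpha> e)"
        using u0[OF eI] r(1) that by simp
      then show ?case using elim sub F_face[OF f] by blast
    qed
  qed
  define L where "L e = face_on_side G p (- rot90 (u e)) e" for e
  define R where "R e = face_on_side G p (rot90 (u e)) e" for e
  have right: "\<forall>\<^sub>F s in at_right (\<alpha> e). F s = g (R e)" if "e \<in> I" for e
  proof -
    have "\<forall>\<^sub>F s in at_right (\<alpha> e). s \<in> {\<alpha> e<..<\<alpha> e + pi}"
      by (rule eventually_at_right_real) simp
    moreover have "\<forall>\<^sub>F s in at_right (\<alpha> e). 0 < 1 * sin (s - \<alpha> e) \<longrightarrow> F s = g (R e)"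
      using filter_leD[OF at_le one_sided[OF that, of 1]] by (simp add: R_def)
    ultimately show ?thesis
      by eventually_elim (auto intro: sin_gt_zero)
  qed
  have left: "\<forall>\<^sub>F s in at_left (\<alpha> e). F s = g (L e)" if "e \<in> I" for e
  proof -
    have "\<forall>\<^sub>F s in at_left (\<alpha> e). s \<in> {\<alpha> e - pi<..<\<alpha> e}"
      by (rule eventually_at_left_real) simp
    moreover have "\<forall>\<^sub>F s in at_left (\<alpha> e). 0 < - 1 * sin (s - \<alpha> e) \<longrightarrow> F s = g (L e)"
      using filter_leD[OF at_le one_sided[OF that, of "-1"]] by (simp add: L_def)
    ultimately show ?thesis
    proof eventually_elim
      case (elim s)
      then have "0 < sin (\<alpha> e - s)" by (intro sin_gt_zero) auto
      then show ?case using elim(2) sin_minus[of "\<alpha> e - s"] by simp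
    qed
  qed
  \<comment> \<open>All angles are in \<open>[0, M]\<close> with \<open>M < 2 * pi\<close>. Starting at \<open>M / 2 - pi\<close>, the middle of the
    remaining gap, the turn neither begins nor ends at an edge and passes each edge once.\<close>
  define M where "M = Max (insert 0 (\<alpha> ` I))"
  have M: "0 \<le> M" "M < 2 * pi" "\<And>e. e \<in> I \<Longrightarrow> \<alpha> e \<le> M"
    using fin \<alpha>(2) by (auto simp: M_def)
  define a where "a = M / 2 - pi"
  have in_period: "\<alpha> ` I \<subseteq> {a<..<a + 2 * pi}"
  proof
    fix t assume "t \<in> \<alpha> ` I"
    then have "0 \<le> t" "t \<le> M" using \<alpha>(1) M(3) by auto
    then show "t \<in> {a<..<a + 2 * pi}" using M(2) by (auto simp: a_def)
  qed
  have "(\<Sum>e\<in>I. g (R e) - g (L e)) =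
      (\<Sum>t\<in>\<alpha> ` I. g (R (the_inv_into I \<alpha> t)) - g (L (the_inv_into I \<alpha> t)))"
    by (simp add: sum.reindex[OF inj] the_inv_into_f_f[OF inj])
  also have "\<dots> = F (a + 2 * pi) - F a"
  proof (rule sum_jumps)
    fix t assume t: "t \<in> {a..a + 2 * pi} - \<alpha> ` I"
    have "c t \<notin> skeleton G p"
    proof
      assume "c t \<in> skeleton G p"
      then obtain e where e: "e \<in> I" "unit_vec t = unit_vec (\<alpha> e)" using hit by blast
      have "\<alpha> e \<in> {a<..<a + 2 * pi}" using in_period e(1) by blast
      then have "\<bar>t - \<alpha> e\<bar> < 2 * pi" using t by auto
      then have "t = \<alpha> e" using unit_vec_eq_imp e(2) by blast
      then show False using t e(1) by blast
    qed
    then show "\<forall>\<^sub>F s in at t. F s = F t" by (rule F_const)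
  qed (use fin in_period left right in \<open>auto simp: the_inv_into_f_f[OF inj]\<close>)
  also have "\<dots> = 0" by (simp add: F_def c_def unit_vec_periodic)
  finally have "(\<Sum>e\<in>I. g (R e) - g (L e)) = 0" .
  moreover have "in_arcs G v \<inter> out_arcs G v = {}"
  proof -
    have "e \<notin> in_arcs G v" if "e \<in> out_arcs G v" for e using that no_loops[of e] by auto
    then show ?thesis by blast
  qed
  then have "(\<Sum>e\<in>I. g (R e) - g (L e)) =
      (\<Sum>e\<in>in_arcs G v. g (R e) - g (L e)) + (\<Sum>e\<in>out_arcs G v. g (R e) - g (L e))"
    using fin unfolding I_def finite_Un by (intro sum.union_disjoint) blast+
  moreover have "(\<Sum>e\<in>out_arcs G v. g (R e) - g (L e)) =
      (\<Sum>e\<in>out_arcs G v. g (left_face G p e) - g (right_face G p e))"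
    by (rule sum.cong) (simp_all add: R_def L_def out left_face_def right_face_def)
  moreover have "(\<Sum>e\<in>in_arcs G v. g (R e) - g (L e)) =
      - (\<Sum>e\<in>in_arcs G v. g (left_face G p e) - g (right_face G p e))"
    unfolding sum_negf[symmetric]
    by (rule sum.cong) (simp_all add: R_def L_def inn rot90_minus left_face_def right_face_def)
  ultimately show ?thesis by (simp add: algebra_simps)
qed

section \<open>Orthogonality and rigidity\<close>

text \<open>Summation by parts moves the difference from the vertex function to the face differences,
  where it vanishes at each vertex: this is \<open>\<partial>\<partial> = 0\<close>.\<close>

lemma face_differences_orthogonal_to_vertex_differences:
  fixes \<eta> :: "(real^2) set \<Rightarrow> 'a::real_inner" and w :: "'v \<Rightarrow> 'a"
  shows "(\<Sum>e\<in>arcs G. (\<eta> (left_face G p e) - \<eta> (right_face G p e)) \<bullet>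
    (w (head G e) - w (tail G e))) = 0"
proof -
  let ?D = "\<lambda>e. \<eta> (left_face G p e) - \<eta> (right_face G p e)"
  have "(\<Sum>e\<in>arcs G. ?D e \<bullet> w (head G e)) =
      (\<Sum>v\<in>verts G. \<Sum>e\<in>in_arcs G v. ?D e \<bullet> w (head G e))"
    unfolding in_arcs_def by (rule sum.group[symmetric]) auto
  also have "\<dots> = (\<Sum>v\<in>verts G. (\<Sum>e\<in>in_arcs G v. ?D e) \<bullet> w v)"
    by (simp add: inner_sum_left)
  also have "\<dots> = (\<Sum>v\<in>verts G. (\<Sum>e\<in>out_arcs G v. ?D e) \<bullet> w v)"
    by (simp add: sum_around_vertex)
  also have "\<dots> = (\<Sum>v\<in>verts G. \<Sum>e\<in>out_arcs G v. ?D e \<bullet> w (tail G e))"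
    by (simp add: inner_sum_left)
  also have "\<dots> = (\<Sum>e\<in>arcs G. ?D e \<bullet> w (tail G e))"
    unfolding out_arcs_def by (rule sum.group) auto
  finally show ?thesis by (simp add: inner_diff_right sum_subtractf)
qed

lemma constant_if_equal_on_arcs:
  assumes eq: "\<And>e. e \<in> arcs G \<Longrightarrow> w (head G e) = w (tail G e)"
    and "x \<in> verts G" and "y \<in> verts G"
  shows "w x = w y"
proof -
  have "x \<rightarrow>\<^sup>*\<^bsub>mk_symmetric G\<^esub> y"
    using connected_graph assms(2,3)
    by (auto simp: Digraph_Component.connected_def strongly_connected_def)
  then have "(x, y) \<in> (arcs_ends (mk_symmetric G))\<^sup>*" by (rule reachable_rtranclI)
  then show ?thesis
  proof (induction rule: rtrancl_induct)
    case (step y z)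
    then obtain e where "e \<in> arcs G"
      and "(y, z) = (tail G e, head G e) \<or> (y, z) = (head G e, tail G e)"
      by (auto simp: parcs_mk_symmetric)
    then have "w y = w z" using eq[of e] by auto
    then show ?case using step.IH by simp
  qed simp
qed

text \<open>The relative displacement \<open>?D e\<close> is the edge rotation \<open>?\<rho> e\<close> plus an axial part, which is
  orthogonal to \<open>?\<rho> e\<close>. So orthogonality of the two difference systems forces \<open>?\<rho> = 0\<close>.\<close>

lemma translation_if_edge_rotations_bounding:
  assumes pres: "preserves_lengths G p w"
    and sat: "\<And>e. e \<in> arcs G \<Longrightarrow>
      perp_proj (edge_vec G p e) (\<eta> (left_face G p e) - \<eta> (right_face G p e)) =
        edge_rotations G w e"
  shows "global_translation G w"
proof -
  let ?\<rho> = "\<lambda>e. w (head G e) - w (tail G e)"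
  let ?D = "\<lambda>e. \<eta> (left_face G p e) - \<eta> (right_face G p e)"
  have "?D e \<bullet> ?\<rho> e = ?\<rho> e \<bullet> ?\<rho> e" if e: "e \<in> arcs G" for e
  proof -
    define k where "k = ?D e \<bullet> edge_vec G p e / (edge_vec G p e \<bullet> edge_vec G p e)"
    have "?\<rho> e = ?D e - k *\<^sub>R edge_vec G p e"
      using sat[OF e] e by (simp add: perp_proj_def edge_rotations_def k_def)
    then have D: "?D e = ?\<rho> e + k *\<^sub>R edge_vec G p e" by (simp add: algebra_simps)
    have "edge_vec G p e \<bullet> ?\<rho> e = 0"
      using pres e by (simp add: preserves_lengths_def inner_commute)
    then show ?thesis by (simp only: D inner_add_left inner_scaleR_left)
  qed
  then have "(\<Sum>e\<in>arcs G. ?\<rho> e \<bullet> ?\<rho> e) = 0"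
    using face_differences_orthogonal_to_vertex_differences[of \<eta> w] by simp
  then have "\<forall>e\<in>arcs G. ?\<rho> e \<bullet> ?\<rho> e = 0"
    using sum_nonneg_eq_0_iff[of "arcs G" "\<lambda>e. ?\<rho> e \<bullet> ?\<rho> e"] by simp
  then have "w (head G e) = w (tail G e)" if "e \<in> arcs G" for e
    using that by simp
  then have const: "w x = w y" if "x \<in> verts G" "y \<in> verts G" for x y
    using constant_if_equal_on_arcs[of w] that by blast
  show ?thesis
  proof (cases "verts G = {}")
    case False
    then obtain x where "x \<in> verts G" by blast
    then show ?thesis using const[of _ x] unfolding global_translation_def by blast
  qed (simp add: global_translation_def)
qed

end

theorem theorem2:
  fixes G :: "('v, 'e) pre_digraph"
    and p w :: "'v \<Rightarrow> real^2"
  assumes "planar_truss G p"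
    and "preserves_lengths G p w"
    and "\<not> global_translation G w"
  shows "(\<forall>\<xi>\<in>H2 G p.
            \<not> (\<exists>\<eta>\<in>carrier (chains2 G p). \<forall>e\<in>arcs G.
                  perp_proj (edge_vec G p e) (\<eta> (left_face G p e) - \<eta> (right_face G p e))
                    = edge_rotations G w e))
       \<and> H1_class G p (edge_rotations G w) \<in> carrier (H1 G p)
       \<and> H1_class G p (edge_rotations G w) \<noteq> \<one>\<^bsub>H1 G p\<^esub>"
proof -
  interpret planar_truss G p by fact
  interpret C1: comm_group "chains1 G p" by (rule comm_group_chains1)
  interpret group_hom "chains2 G p" "chains1 G p" "boundary G p" by (rule group_hom_boundary)
  let ?B = "boundary G p ` carrier (chains2 G p)"
  have unsat: "\<not> (\<exists>\<eta>. \<forall>e\<in>arcs G.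
      perp_proj (edge_vec G p e) (\<eta> (left_face G p e) - \<eta> (right_face G p e)) =
        edge_rotations G w e)"
    using translation_if_edge_rotations_bounding[OF assms(2)] assms(3) by metis
  have \<rho>: "edge_rotations G w \<in> carrier (chains1 G p)"
    using assms(2) by (rule edge_rotations_in_chains1)
  have "edge_rotations G w \<notin> ?B"
  proof
    assume "edge_rotations G w \<in> ?B"
    then obtain \<eta> where \<eta>: "edge_rotations G w = boundary G p \<eta>" by blast
    have "perp_proj (edge_vec G p e) (\<eta> (left_face G p e) - \<eta> (right_face G p e)) =
        edge_rotations G w e" if "e \<in> arcs G" for e
      unfolding \<eta> using that by (simp add: boundary_def)
    then show False using unsat by blast
  qed
  then have "H1_class G p (edge_rotations G w) \<noteq> \<one>\<^bsub>H1 G p\<^esub>"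
    using C1.coset_join1[OF _ \<rho> img_is_subgroup] unfolding H1_class_def H1_def one_FactGroup
    by blast
  moreover have "H1_class G p (edge_rotations G w) \<in> carrier (H1 G p)"
    using \<rho> unfolding H1_class_def H1_def carrier_FactGroup by (rule imageI)
  ultimately show ?thesis using unsat by blast
qed

end
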